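(* Let $\{z_k\}_{k\ge0}\subset\mathbb{R}^N$ be a sequence generated by Algorithm ISSNG-L (described in the context), so that for each $k$ the direction $d_k$ satisfies $\|F(z_k)+G(z_k)d_k\|\le\eta_k\|F(z_k)\|$ with $\eta_k\le\eta_{\max}$ for a constant $\eta_{\max}\in[0,1)$. Assume that Assumptions A, B and C of the context hold, that $\nabla Q(z_k)\ne0$ for all $k$, that $c_1\le\frac12$, and that $\eta_k\to0$. Suppose $z^*$ is a limit point of $\{z_k\}$. Then the sequence $\{z_k\}$ converges to $z^*$ and $\|F(z^* )\|=0$.
   Context: Discrete problem. Let $\Omega=(0,1)^2$, $\alpha>0$, $u_a,u_b$ (bounds, $u_a\le u_b$), $f,y_d$ given functions on $\Omega$, and $S:\mathbb{R}\to\mathbb{R}$ a nonlinear function with $S\in W^{2,\infty}(-R,R)$ for every $R>0$, $S'(y)\in L^2(\Omega)$ for every $y\in H^1(\Omega)$, and $S'\ge 0$. Fix $n$, $h=1/n$, and the uniform grid on $\Omega$ with $(n-1)^2$ interior points; set $N=2(n-1)^2$. Let $\Delta_h=(I\otimes J_h)+(J_h\otimes I)$ with $J_h=\mathrm{tridiag}(1,-2,1)/h^2\in\mathbb{R}^{(n-1)\times(n-1)}$ be the five-point discrete Laplacian (zero Dirichlet boundary conditions), and $f_h,y_{dh}$ the vectors of values of $f,y_d$ at interior grid points. Let $\Phi(v)=\max\{u_a,\min\{u_b,v\}\}$. Functions of vectors ($S$, $S'$, $S''$, $\Phi$, $\partial\Phi$) and products of vectors such as $S'(y_h)p_h$ are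 componentwise. For $z=[y_h;p_h]\in\mathbb{R}^N$ put $$F(z)=\begin{bmatrix}-\Delta_h y_h+S(y_h)-\Phi(p_h/\alpha)-f_h\\ -\Delta_h p_h+S'(y_h)p_h+y_h-y_{dh}\end{bmatrix},\qquad G(z)=\begin{bmatrix}-\Delta_h+\Psi(S'(y_h)) & -\frac1\alpha\Psi(\partial\Phi(p_h/\alpha))\\ I+\Psi(S''(y_h)p_h) & -\Delta_h+\Psi(S'(y_h))\end{bmatrix},$$ where $\Psi(v)$ is the diagonal matrix with diagonal $v$, and $\partial\Phi(v)=1$ if $u_a<v<u_b$ and $0$ otherwise. $G$ is a slanting function for $F$: $\lim_{d\to0}\|F(z+d)-F(z)-G(z+d)d\|/\|d\|=0$ for every $z$. $\|\cdot\|$ is the discrete $L^2$-norm $\|v\|=(h^2\sum_i v_i^2)^{1/2}$ (and the induced matrix norm); $a^Tb$ and gradients are understood with respect to the corresponding inner product. The merit function is $Q(z)=\frac12\|F(z)\|^2$, and its gradient is $\nabla Q(z)=G(z)^TF(z)$. Assumption A: $S\in C^3$, $S'\ge0$, and $S''(y)p+1\ge\kappa_1$ for some $\kappa_1>0$ in some neighborhood of the optimal $y^*$ and $p^*$. Under Assumption A the following is a known fact used throughout: $G(z)$ is invertible and there is a constant $M>0$ with $\|G(z)^{-1}\|\le M$ and $\|G(z)\|\le M$ for all $z$. Assumption B: with $z^*$ an optimal solution, there exist positive constants $L,\delta_1$ such that for $\|z_k-z^*\|<\delta_1$ and all sufficiently small $d$, $\|G(z_k+d)-G(z_k)\|\le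 \frac{L\|d\|}{M}$. Assumption C: the sequence $\{z_k\}$ generated by the algorithm is contained in the compact set $L(z_0)=\{z:\|F(z)\|\le\|F(z_0)\|\}$. Algorithm ISSNG-L. Given $c_1\in(0,1)$, $\delta_0\in(0,1]$, $\eta_{\max}\in[0,1)$, $0<\theta_{\min}<\theta_{\max}<1$, and $z_0$. For $k=0,1,2,\dots$: choose $\eta_k\in[0,\eta_{\max}]$ and compute $d_k$ (by GMRES applied to $G(z_k)d_k=-F(z_k)$) with $\|F(z_k)+G(z_k)d_k\|\le\eta_k\|F(z_k)\|$; choose $\theta\in[\theta_{\min},\theta_{\max}]$; starting from the trial step ($\delta_0$ for $k=0$, and $\delta_k=1$ for $k\ge1$), replace $\delta_k$ by $\theta\delta_k$ as long as $$Q(z_k+\delta_kd_k)>\max_{0\le j\le k}Q(z_j)+c_1\delta_k\nabla Q(z_k)^Td_k;$$ then set $z_{k+1}=z_k+\delta_kd_k$. The stopping test is ignored, so that an infinite sequence is generated.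
   Formalization: The limit point z* is also assumed to be the optimal solution of Assumptions A and B, read as a global minimiser of Q; for an arbitrary limit point the claim fails, since full Newton steps can cycle with F nonzero when the line search compares with the maximum over all earlier iterates. *)

theory Defs
  imports "HOL-Analysis.Analysis"
begin

section \<open>Grid, discrete norm, block matrices\<close>

text \<open>
  Each coordinate direction has \<open>n - 1\<close> interior nodes, indexed by a finite linearly
  ordered type \<open>'m\<close> with \<open>CARD('m) = n - 1\<close>. Nodes of the square are pairs, and
  \<open>z = [y; p]\<close> is indexed by the disjoint sum of two copies of the nodes, so its
  dimension is \<open>2 (n - 1)^2\<close>.
\<close>

type_synonym 'm node = "'m \<times> 'm"
type_synonym 'm gridfun = "real ^ 'm node"
type_synonym 'm pairfun = "real ^ ('m node + 'm node)"
type_synonym 'm pairmat = "real ^ ('m node + 'm node) ^ ('m node + 'm node)"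

definition Omega :: "(real \<times> real) set" where
  "Omega = {0<..<1} \<times> {0<..<1}"

text \<open>The one-based position of a node index: the \<open>i\<close>-th node lies at \<open>i h\<close>.\<close>

definition pos :: "'m::{finite,linorder} \<Rightarrow> nat" where
  "pos i = card {j. j \<le> i}"

definition grid_point :: "real \<Rightarrow> 'm::{finite,linorder} node \<Rightarrow> real \<times> real" where
  "grid_point h = (\<lambda>(i, j). (real (pos i) * h, real (pos j) * h))"

definition grid_values :: "real \<Rightarrow> (real \<times> real \<Rightarrow> real) \<Rightarrow> 'm::{finite,linorder} gridfun" where
  "grid_values h g = (\<chi> i. g (grid_point h i))"

definition dnorm :: "real \<Rightarrow> real ^ 'k::finite \<Rightarrow> real" where
  "dnorm h v = sqrt (h\<^sup>2 * (\<Sum>i\<in>UNIV. (v $ i)\<^sup>2))"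

definition dinner :: "real \<Rightarrow> real ^ 'k::finite \<Rightarrow> real ^ 'k \<Rightarrow> real" where
  "dinner h v w = h\<^sup>2 * (\<Sum>i\<in>UNIV. v $ i * w $ i)"

definition dmatnorm :: "real \<Rightarrow> real ^ 'k::finite ^ 'k \<Rightarrow> real" where
  "dmatnorm h A = (SUP v. dnorm h (A *v v) / dnorm h v)"

definition kron :: "real ^ 'a::finite ^ 'a \<Rightarrow> real ^ 'b::finite ^ 'b \<Rightarrow> real ^ ('a \<times> 'b) ^ ('a \<times> 'b)" where
  "kron A B = (\<chi> i j. A $ fst i $ fst j * B $ snd i $ snd j)"

definition J_mat :: "real \<Rightarrow> real ^ 'm::{finite,linorder} ^ 'm::{finite,linorder}" where
  "J_mat h = (\<chi> i j.
     (if i = j then -2 else if pos i = Suc (pos j) \<or> pos j = Suc (pos i) then 1 else 0) / h\<^sup>2)"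

definition laplacian :: "real \<Rightarrow> real ^ ('m::{finite,linorder} \<times> 'm) ^ ('m \<times> 'm)" where
  "laplacian h = kron (mat 1) (J_mat h) + kron (J_mat h) (mat 1)"

definition Psi :: "real ^ 'k::finite \<Rightarrow> real ^ 'k ^ 'k" where
  "Psi v = (\<chi> i j. if i = j then v $ i else 0)"

definition vmap :: "(real \<Rightarrow> real) \<Rightarrow> real ^ 'k::finite \<Rightarrow> real ^ 'k" where
  "vmap g v = (\<chi> i. g (v $ i))"

definition stack :: "real ^ 'a::finite \<Rightarrow> real ^ 'b::finite \<Rightarrow> real ^ ('a + 'b)" where
  "stack v w = (\<chi> k. case k of Inl i \<Rightarrow> v $ i | Inr i \<Rightarrow> w $ i)"

definition upper :: "real ^ ('a::finite + 'b::finite) \<Rightarrow> real ^ 'a" where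
  "upper z = (\<chi> i. z $ Inl i)"

definition lower :: "real ^ ('a::finite + 'b::finite) \<Rightarrow> real ^ 'b" where
  "lower z = (\<chi> i. z $ Inr i)"

definition block_mat ::
  "real ^ 'a::finite ^ 'a \<Rightarrow> real ^ 'b::finite ^ 'a \<Rightarrow> real ^ 'a ^ 'b \<Rightarrow> real ^ 'b ^ 'b
    \<Rightarrow> real ^ ('a + 'b) ^ ('a + 'b)" where
  "block_mat A B C D = (\<chi> k. case k of
      Inl i \<Rightarrow> stack (A $ i) (B $ i)
    | Inr i \<Rightarrow> stack (C $ i) (D $ i))"

section \<open>The discrete optimality system\<close>

text \<open>
  The bounds may vary over the square; they are evaluated at the grid points. Constant
  bounds are the special case of constant functions.
\<close>

definition Phi :: "real \<Rightarrow> (real \<times> real \<Rightarrow> real) \<Rightarrow> (real \<times> real \<Rightarrow> real)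
    \<Rightarrow> 'm::{finite,linorder} gridfun \<Rightarrow> 'm gridfun" where
  "Phi h ua ub v = (\<chi> i. max (ua (grid_point h i)) (min (ub (grid_point h i)) (v $ i)))"

definition dPhi :: "real \<Rightarrow> (real \<times> real \<Rightarrow> real) \<Rightarrow> (real \<times> real \<Rightarrow> real)
    \<Rightarrow> 'm::{finite,linorder} gridfun \<Rightarrow> 'm gridfun" where
  "dPhi h ua ub v =
     (\<chi> i. if ua (grid_point h i) < v $ i \<and> v $ i < ub (grid_point h i) then 1 else 0)"

text \<open>Multiplication of two vectors, as in \<open>vmap (deriv S) y * p\<close>, is componentwise.\<close>

definition residual_F :: "real \<Rightarrow> real \<Rightarrow> (real \<times> real \<Rightarrow> real) \<Rightarrow> (real \<times> real \<Rightarrow> real)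
    \<Rightarrow> (real \<times> real \<Rightarrow> real) \<Rightarrow> (real \<times> real \<Rightarrow> real) \<Rightarrow> (real \<Rightarrow> real)
    \<Rightarrow> 'm::{finite,linorder} pairfun \<Rightarrow> 'm pairfun" where
  "residual_F h \<alpha> ua ub f yd S z =
    (let y = upper z; p = lower z in
     stack
       (- (laplacian h *v y) + vmap S y - Phi h ua ub ((1/\<alpha>) *\<^sub>R p) - grid_values h f)
       (- (laplacian h *v p) + vmap (deriv S) y * p + y - grid_values h yd))"

definition slanting_G :: "real \<Rightarrow> real \<Rightarrow> (real \<times> real \<Rightarrow> real) \<Rightarrow> (real \<times> real \<Rightarrow> real)
    \<Rightarrow> (real \<Rightarrow> real) \<Rightarrow> 'm::{finite,linorder} pairfun \<Rightarrow> 'm pairmat" where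
  "slanting_G h \<alpha> ua ub S z =
    (let y = upper z; p = lower z in
     block_mat
       (- laplacian h + Psi (vmap (deriv S) y))    (- ((1/\<alpha>) *\<^sub>R Psi (dPhi h ua ub ((1/\<alpha>) *\<^sub>R p))))
       (mat 1 + Psi (vmap (deriv (deriv S)) y * p)) (- laplacian h + Psi (vmap (deriv S) y)))"

definition merit :: "real \<Rightarrow> ('m::{finite,linorder} pairfun \<Rightarrow> 'm pairfun) \<Rightarrow> 'm pairfun \<Rightarrow> real" where
  "merit h F z = (dnorm h (F z))\<^sup>2 / 2"

definition grad_merit :: "('m::{finite,linorder} pairfun \<Rightarrow> 'm pairfun) \<Rightarrow> ('m pairfun \<Rightarrow> 'm pairmat)
    \<Rightarrow> 'm pairfun \<Rightarrow> 'm pairfun" where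
  "grad_merit F G z = transpose (G z) *v F z"

section \<open>Function spaces for the nonlinearity\<close>

definition C_k :: "nat \<Rightarrow> (real \<Rightarrow> real) \<Rightarrow> bool" where
  "C_k k g \<longleftrightarrow> (\<forall>j<k. \<forall>x. (deriv ^^ j) g differentiable (at x)) \<and> continuous_on UNIV ((deriv ^^ k) g)"

definition pd1 :: "(real \<times> real \<Rightarrow> real) \<Rightarrow> real \<times> real \<Rightarrow> real" where
  "pd1 g = (\<lambda>(s, t). deriv (\<lambda>r. g (r, t)) s)"

definition pd2 :: "(real \<times> real \<Rightarrow> real) \<Rightarrow> real \<times> real \<Rightarrow> real" where
  "pd2 g = (\<lambda>(s, t). deriv (\<lambda>r. g (s, r)) t)"

text \<open>Infinitely differentiable: all iterated partial derivatives exist and are continuous.\<close>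

definition smooth_fun :: "(real \<times> real \<Rightarrow> real) \<Rightarrow> bool" where
  "smooth_fun g \<longleftrightarrow> (\<forall>Ds. set Ds \<subseteq> {pd1, pd2} \<longrightarrow>
     (let u = foldr id Ds g in
       continuous_on UNIV u \<and>
       (\<forall>s t. (\<lambda>r. u (r, t)) differentiable (at s) \<and> (\<lambda>r. u (s, r)) differentiable (at t))))"

definition test_fun :: "(real \<times> real \<Rightarrow> real) \<Rightarrow> bool" where
  "test_fun g \<longleftrightarrow> smooth_fun g \<and> compact (closure {x. g x \<noteq> 0}) \<and> closure {x. g x \<noteq> 0} \<subseteq> Omega"

definition L2_Omega :: "(real \<times> real \<Rightarrow> real) set" where
  "L2_Omega = {g. set_borel_measurable lebesgue Omega g \<and> set_integrable lebesgue Omega (\<lambda>x. (g x)\<^sup>2)}"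

definition H1_Omega :: "(real \<times> real \<Rightarrow> real) set" where
  "H1_Omega = {y \<in> L2_Omega. \<exists>g1\<in>L2_Omega. \<exists>g2\<in>L2_Omega. \<forall>\<phi>. test_fun \<phi> \<longrightarrow>
     (LINT x:Omega|lebesgue. y x * pd1 \<phi> x) = - (LINT x:Omega|lebesgue. g1 x * \<phi> x) \<and>
     (LINT x:Omega|lebesgue. y x * pd2 \<phi> x) = - (LINT x:Omega|lebesgue. g2 x * \<phi> x)}"

section \<open>Assumptions and algorithm\<close>

text \<open>
  ``Optimal solution'' is read as a minimiser of the merit function. Every zero of \<open>F\<close>
  is one, so this is no more restrictive than asking that \<open>zs\<close> solve the discrete
  optimality system; it does not presuppose \<open>F zs = 0\<close>.
\<close>

definition optimal_solution :: "real \<Rightarrow> ('m::{finite,linorder} pairfun \<Rightarrow> 'm pairfun)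
    \<Rightarrow> 'm pairfun \<Rightarrow> bool" where
  "optimal_solution h F zs \<longleftrightarrow> (\<forall>z. merit h F zs \<le> merit h F z)"

definition assumption_A :: "real \<Rightarrow> (real \<Rightarrow> real) \<Rightarrow> 'm::{finite,linorder} pairfun \<Rightarrow> bool" where
  "assumption_A h S zs \<longleftrightarrow> C_k 3 S \<and> (\<forall>x. deriv S x \<ge> 0) \<and>
     (\<exists>\<kappa>>0. \<exists>\<epsilon>>0. \<forall>z. dnorm h (z - zs) < \<epsilon> \<longrightarrow>
        (\<forall>i. deriv (deriv S) (upper z $ i) * lower z $ i + 1 \<ge> \<kappa>))"

definition level_set :: "real \<Rightarrow> ('m::{finite,linorder} pairfun \<Rightarrow> 'm pairfun) \<Rightarrow> 'm pairfun
    \<Rightarrow> 'm pairfun set" where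
  "level_set h F z0 = {z. dnorm h (F z) \<le> dnorm h (F z0)}"

text \<open>
  The uniform bounds on \<open>G\<close> and its inverse are required on a set \<open>K\<close>. On the whole
  space they would force \<open>S\<close> to be affine, since \<open>G z\<close> contains the
  product of \<open>p\<close> with the second derivative of \<open>S\<close> at \<open>y\<close>.
\<close>

definition G_bounds :: "real \<Rightarrow> ('m::{finite,linorder} pairfun \<Rightarrow> 'm pairmat) \<Rightarrow> real
    \<Rightarrow> 'm pairfun set \<Rightarrow> bool" where
  "G_bounds h G M K \<longleftrightarrow> M > 0 \<and>
     (\<forall>z\<in>K. invertible (G z) \<and> dmatnorm h (matrix_inv (G z)) \<le> M \<and> dmatnorm h (G z) \<le> M)"

definition assumption_B :: "real \<Rightarrow> ('m::{finite,linorder} pairfun \<Rightarrow> 'm pairmat) \<Rightarrow> real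
    \<Rightarrow> (nat \<Rightarrow> 'm pairfun) \<Rightarrow> 'm pairfun \<Rightarrow> bool" where
  "assumption_B h G M z zs \<longleftrightarrow> (\<exists>L>0. \<exists>\<delta>1>0. \<forall>k. dnorm h (z k - zs) < \<delta>1 \<longrightarrow>
     (\<forall>\<^sub>F d in nhds 0. dmatnorm h (G (z k + d) - G (z k)) \<le> L * dnorm h d / M))"

definition assumption_C :: "real \<Rightarrow> ('m::{finite,linorder} pairfun \<Rightarrow> 'm pairfun)
    \<Rightarrow> (nat \<Rightarrow> 'm pairfun) \<Rightarrow> bool" where
  "assumption_C h F z \<longleftrightarrow> compact (level_set h F (z 0)) \<and> (\<forall>k. z k \<in> level_set h F (z 0))"

definition step_accepted :: "real \<Rightarrow> ('m::{finite,linorder} pairfun \<Rightarrow> 'm pairfun)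
    \<Rightarrow> ('m pairfun \<Rightarrow> 'm pairmat) \<Rightarrow> real \<Rightarrow> (nat \<Rightarrow> 'm pairfun) \<Rightarrow> 'm pairfun \<Rightarrow> nat \<Rightarrow> real \<Rightarrow> bool" where
  "step_accepted h F G c1 z dk k t \<longleftrightarrow>
     merit h F (z k + t *\<^sub>R dk)
       \<le> (MAX j\<in>{..k}. merit h F (z j)) + c1 * t * dinner h (grad_merit F G (z k)) dk"

text \<open>
  The directions are arbitrary vectors meeting the residual tolerance; how the inner solver
  finds them is immaterial. The accepted step is the trial step after \<open>m\<close> reductions,
  where \<open>m\<close> is the first count at which the line search test is passed.
\<close>

definition ISSNG_L :: "real \<Rightarrow> ('m::{finite,linorder} pairfun \<Rightarrow> 'm pairfun)
    \<Rightarrow> ('m pairfun \<Rightarrow> 'm pairmat) \<Rightarrow> real \<Rightarrow> real \<Rightarrow> real \<Rightarrow> real \<Rightarrow> real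
    \<Rightarrow> (nat \<Rightarrow> real) \<Rightarrow> (nat \<Rightarrow> 'm pairfun) \<Rightarrow> (nat \<Rightarrow> real) \<Rightarrow> (nat \<Rightarrow> 'm pairfun) \<Rightarrow> bool" where
  "ISSNG_L h F G c1 \<delta>init \<eta>max \<theta>min \<theta>max \<eta> d \<delta> z \<longleftrightarrow>
     (\<forall>k. \<eta> k \<in> {0..\<eta>max} \<and>
          dnorm h (F (z k) + G (z k) *v d k) \<le> \<eta> k * dnorm h (F (z k)) \<and>
          (\<exists>\<theta>\<in>{\<theta>min..\<theta>max}. \<exists>m. let trial = (if k = 0 then \<delta>init else 1) in
             \<delta> k = \<theta> ^ m * trial \<and>
             step_accepted h F G c1 z (d k) k (\<theta> ^ m * trial) \<and>
             (\<forall>j<m. \<not> step_accepted h F G c1 z (d k) k (\<theta> ^ j * trial))) \<and>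
          z (Suc k) = z k + \<delta> k *\<^sub>R d k)"

end

theory Submission
  imports Defs "HOL-Library.Landau_Symbols"
begin

text \<open>
  The line search compares with the maximum over all earlier iterates, hence never with less than
  \<open>Q(z\<^sub>0) > 0\<close>. Near a zero of \<open>F\<close> the unit step therefore always passes the test, and the
  method is locally an inexact semismooth Newton iteration, which halves the distance to the zero
  once \<open>\<eta>\<^sub>k\<close> is small. One iterate close to the limit point is enough to capture the whole tail.

  The limit point is only known to minimise \<open>\<parallel>F\<parallel>\<close>. Write \<open>F z* = (r\<^sub>1, r\<^sub>2)\<close>,
  \<open>A = -\<Delta>\<^sub>h + \<Psi>(S'(y))\<close> and \<open>C = I + \<Psi>(S''(y)p)\<close>. Moving \<open>y\<close> gives \<open>A r\<^sub>1 + C r\<^sub>2 = 0\<close>; moving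
  \<open>p\<close> in direction \<open>r\<^sub>1\<close>, where the contribution of \<open>\<Phi>\<close> has a favourable sign even at a kink,
  gives \<open>r\<^sub>2 \<bullet> A r\<^sub>1 \<ge> 0\<close>. So \<open>r\<^sub>2 \<bullet> C r\<^sub>2 \<le> 0\<close>, whence \<open>r\<^sub>2 = 0\<close> as \<open>C\<close> is positive, and
  \<open>r\<^sub>1 = 0\<close> because \<open>A\<close> is injective by the discrete maximum principle.
\<close>

section \<open>The discrete Laplacian\<close>

lemma dnorm_eq_norm: "0 < h \<Longrightarrow> dnorm h v = h * norm v"
  by (simp add: dnorm_def norm_vec_def L2_set_def real_sqrt_mult)

lemma dinner_eq_inner: "dinner h v w = h\<^sup>2 * (v \<bullet> w)"
  by (simp add: dinner_def inner_vec_def)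

lemma dmatnorm_eq_onorm: "0 < h \<Longrightarrow> dmatnorm h A = onorm ((*v) A)"
  by (simp add: dmatnorm_def onorm_def dnorm_eq_norm)

lemma norm_matrix_vector_le_dmatnorm:
  "0 < h \<Longrightarrow> norm (A *v v) \<le> dmatnorm h A * norm v"
  by (simp add: dmatnorm_eq_onorm onorm matrix_vector_mul_bounded_linear)

lemma upper_stack [simp]: "upper (stack v w) = v"
  and lower_stack [simp]: "lower (stack v w) = w"
  by (simp_all add: upper_def lower_def stack_def vec_eq_iff)

lemma stack_upper_lower [simp]: "stack (upper z) (lower z) = z"
  by (auto simp: upper_def lower_def stack_def vec_eq_iff split: sum.split)

lemma upper_lower_linear [simp]:
  "upper (v + w) = upper v + upper w" "lower (v + w) = lower v + lower w"
  "upper (v - w) = upper v - upper w" "lower (v - w) = lower v - lower w"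
  "upper (c *\<^sub>R v) = c *\<^sub>R upper v" "lower (c *\<^sub>R v) = c *\<^sub>R lower v"
  by (simp_all add: upper_def lower_def vec_eq_iff)

lemma sum_UNIV_sum:
  fixes g :: "'a::finite + 'b::finite \<Rightarrow> 'c::comm_monoid_add"
  shows "(\<Sum>k\<in>UNIV. g k) = (\<Sum>i\<in>UNIV. g (Inl i)) + (\<Sum>i\<in>UNIV. g (Inr i))"
  using sum.Plus[of UNIV UNIV g] by (simp add: comp_def)

lemma inner_upper_lower: "v \<bullet> w = upper v \<bullet> upper w + lower v \<bullet> lower w"
  by (simp add: inner_vec_def sum_UNIV_sum upper_def lower_def)

lemma block_mat_mult_vec:
  "block_mat A B C D *v v = stack (A *v upper v + B *v lower v) (C *v upper v + D *v lower v)"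
  by (auto simp: vec_eq_iff matrix_vector_mult_def block_mat_def stack_def sum_UNIV_sum
      upper_def lower_def split: sum.split)

lemma Psi_mult_vec: "Psi v *v w = v * w"
proof -
  have "(Psi v *v w) $ i = (\<Sum>j\<in>UNIV. if i = j then v $ i * w $ i else 0)" for i
    unfolding matrix_vector_mult_def vec_lambda_beta by (rule sum.cong) (auto simp: Psi_def)
  then show ?thesis by (simp add: vec_eq_iff)
qed

section \<open>Node positions and the difference matrices in coordinates\<close>

lemma inj_pos: "inj (pos :: 'm::{finite,linorder} \<Rightarrow> nat)"
proof (rule linorder_injI)
  fix i j :: 'm
  assume "i < j"
  then have "{k. k \<le> i} \<subseteq> {k. k \<le> j}" "j \<in> {k. k \<le> j} - {k. k \<le> i}" by auto
  then have "{k. k \<le> i} \<subset> {k. k \<le> j}" by blast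
  then show "pos i \<noteq> pos j"
    unfolding pos_def using psubset_card_mono[of "{k. k \<le> j}" "{k. k \<le> i}"] by simp
qed

lemma pos_bounds: "0 < pos (i :: 'm::{finite,linorder})" "pos (i :: 'm) \<le> CARD('m)"
proof -
  have "i \<in> {j. j \<le> i}" by simp
  then show "0 < pos i" unfolding pos_def by (metis card_gt_0_iff empty_iff finite_code)
  show "pos i \<le> CARD('m)" unfolding pos_def by (rule card_mono) simp_all
qed

text \<open>Each neighbour sum runs over at most one node. Where the neighbour is missing the sum is
  empty, which is exactly the zero Dirichlet value, so boundary nodes obey the same formula.\<close>

lemma J_mat_mult_vec:
  fixes v :: "real ^ 'm::{finite,linorder}"
  shows "h\<^sup>2 * (J_mat h *v v) $ i = (if h = 0 then 0 else
    - 2 * v $ i + sum (($) v) {j. pos i = Suc (pos j)} + sum (($) v) {j. pos j = Suc (pos i)})"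
proof (cases "h = 0")
  case False
  have "h\<^sup>2 * (J_mat h *v v) $ i =
      (\<Sum>j\<in>UNIV. (if j = i then - 2 * v $ i else 0) + (if pos i = Suc (pos j) then v $ j else 0)
        + (if pos j = Suc (pos i) then v $ j else 0))"
    unfolding matrix_vector_mult_def sum_distrib_left vec_lambda_beta
    by (rule sum.cong) (use False in \<open>auto simp: J_mat_def\<close>)
  also have "\<dots> = - 2 * v $ i + sum (($) v) {j. pos i = Suc (pos j)} + sum (($) v) {j. pos j = Suc (pos i)}"
    by (simp add: sum.distrib sum.delta sum.If_cases)
  finally show ?thesis using False by simp
qed (simp add: J_mat_def matrix_vector_mult_def)

lemma kron_mat1_left_mult_vec:
  "(kron (mat 1) B *v v) $ (i, k) = (B *v (\<chi> l. v $ (i, l))) $ k"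
proof -
  have "(kron (mat 1) B *v v) $ (i, k) =
      (\<Sum>(a, b)\<in>UNIV \<times> UNIV. if i = a then B $ k $ b * v $ (i, b) else 0)"
    unfolding matrix_vector_mult_def vec_lambda_beta UNIV_Times_UNIV
    by (rule sum.cong) (auto simp: kron_def mat_def)
  also have "\<dots> = (\<Sum>b\<in>UNIV. \<Sum>a\<in>UNIV. if i = a then B $ k $ b * v $ (i, b) else 0)"
    by (subst sum.cartesian_product[symmetric], subst sum.swap) simp
  finally show ?thesis by (simp add: matrix_vector_mult_def)
qed

lemma kron_mat1_right_mult_vec:
  "(kron A (mat 1) *v v) $ (i, k) = (A *v (\<chi> l. v $ (l, k))) $ i"
proof -
  have "(kron A (mat 1) *v v) $ (i, k) =
      (\<Sum>(a, b)\<in>UNIV \<times> UNIV. if k = b then A $ i $ a * v $ (a, k) else 0)"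
    unfolding matrix_vector_mult_def vec_lambda_beta UNIV_Times_UNIV
    by (rule sum.cong) (auto simp: kron_def mat_def)
  also have "\<dots> = (\<Sum>a\<in>UNIV. \<Sum>b\<in>UNIV. if k = b then A $ i $ a * v $ (a, k) else 0)"
    by (subst sum.cartesian_product[symmetric]) simp
  finally show ?thesis by (simp add: matrix_vector_mult_def)
qed

lemma laplacian_mult_vec:
  "(laplacian h *v v) $ (i, k) =
    (J_mat h *v (\<chi> l. v $ (i, l))) $ k + (J_mat h *v (\<chi> l. v $ (l, k))) $ i"
  by (simp add: laplacian_def matrix_vector_mult_add_rdistrib kron_mat1_left_mult_vec
      kron_mat1_right_mult_vec)

lemma symmetric_laplacian: "(laplacian h *v v) \<bullet> w = v \<bullet> (laplacian h *v w)"
proof -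
  have "transpose (laplacian h) = (laplacian h :: real ^ ('a \<times> 'a) ^ ('a \<times> 'a))"
    by (auto simp: transpose_def laplacian_def kron_def J_mat_def mat_def vec_eq_iff)
  then show ?thesis
    using dot_lmul_matrix[of v "laplacian h" w] transpose_matrix_vector[of "laplacian h" v] by simp
qed

section \<open>Discrete maximum principle\<close>

lemma sum_le_if_card_le_1:
  fixes g :: "'a::finite \<Rightarrow> real"
  assumes "\<And>i j. i \<in> N \<Longrightarrow> j \<in> N \<Longrightarrow> i = j" "\<And>i. i \<in> N \<Longrightarrow> g i \<le> m" "0 \<le> m"
  shows "sum g N \<le> m"
proof (cases "N = {}")
  case False
  then obtain a where "N = {a}" using assms(1) by blast
  then show ?thesis using assms(2) by simp
qed (use assms in simp)

lemma sum_less_if_card_le_1: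
  fixes g :: "'a::finite \<Rightarrow> real"
  assumes "\<And>i j. i \<in> N \<Longrightarrow> j \<in> N \<Longrightarrow> i = j" "\<And>i. i \<in> N \<Longrightarrow> g i < m" "0 < m"
  shows "sum g N < m"
proof (cases "N = {}")
  case False
  then obtain a where "N = {a}" using assms(1) by blast
  then show ?thesis using assms(2) by simp
qed (use assms in simp)

text \<open>A missing neighbour counts as zero, which is below the positive maximum, so each
  neighbour sum is at most \<open>v $ i\<close> and together they cannot outweigh
  \<open>- 2 * v $ i\<close>. A strictly smaller or missing successor makes the inequality
  strict.\<close>

lemma J_mat_nonpos_at_maximum:
  fixes v :: "real ^ 'm::{finite,linorder}"
  assumes "\<And>j. v $ j \<le> v $ i" "0 < v $ i" "0 < h"
  shows "(J_mat h *v v) $ i \<le> 0"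
    and "(\<And>j. pos i < pos j \<Longrightarrow> v $ j < v $ i) \<Longrightarrow> (J_mat h *v v) $ i < 0"
proof -
  have inj: "j = k" if "pos j = pos k" for j k :: 'm
    using injD[OF inj_pos that] .
  let ?L = "sum (($) v) {j. pos i = Suc (pos j)}" and ?U = "sum (($) v) {j. pos j = Suc (pos i)}"
  have L: "?L \<le> v $ i" and U: "?U \<le> v $ i"
    by (intro sum_le_if_card_le_1; use assms inj in auto)+
  have eq: "h\<^sup>2 * (J_mat h *v v) $ i = - 2 * v $ i + ?L + ?U"
    using assms(3) by (simp add: J_mat_mult_vec)
  then have "h\<^sup>2 * (J_mat h *v v) $ i \<le> 0" using L U by simp
  then show "(J_mat h *v v) $ i \<le> 0"
    using assms(3) by (simp add: mult_le_0_iff)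
  assume strict: "\<And>j. pos i < pos j \<Longrightarrow> v $ j < v $ i"
  have "?U < v $ i"
    by (intro sum_less_if_card_le_1) (use assms inj strict in auto)
  then have "h\<^sup>2 * (J_mat h *v v) $ i < 0" using L eq by simp
  then show "(J_mat h *v v) $ i < 0"
    using assms(3) by (simp add: mult_less_0_iff)
qed

text \<open>At a positive maximum both second differences are nonpositive and \<open>s * v\<close>
  is nonnegative. A maximiser that is extreme in the first direction makes one difference strictly
  negative, so the equation fails there.\<close>

lemma discrete_maximum_principle:
  fixes v s :: "'m::{finite,linorder} gridfun"
  assumes "- (laplacian h *v v) + s * v = 0" "\<And>i. 0 \<le> s $ i" "0 < h"
  shows "v $ x \<le> 0"
proof (rule ccontr)
  define m where "m = Max (range (($) v))"
  have le: "v $ y \<le> m" for y by (simp add: m_def)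
  assume "\<not> v $ x \<le> 0"
  then have m: "0 < m" using le[of x] by simp
  have "m \<in> range (($) v)" unfolding m_def by (rule Max_in) auto
  then obtain y where "m = v $ y" by auto
  then have "y \<in> {y. v $ y = m}" by simp
  then have "{y. v $ y = m} \<noteq> {}" by blast
  \<comment> \<open>The maximiser furthest in the first direction has no equal neighbour on that side.\<close>
  obtain i k where ik: "v $ (i, k) = m"
    and far: "\<And>i' k'. v $ (i', k') = m \<Longrightarrow> pos i' \<le> pos i"
  proof -
    let ?Y = "{y. v $ y = m}"
    have "Max ((\<lambda>y. pos (fst y)) ` ?Y) \<in> (\<lambda>y. pos (fst y)) ` ?Y"
      by (rule Max_in) (use \<open>?Y \<noteq> {}\<close> in simp_all)
    then obtain y where "y \<in> ?Y" "pos (fst y) = Max ((\<lambda>y. pos (fst y)) ` ?Y)" by auto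
    moreover have "pos (fst y') \<le> Max ((\<lambda>y. pos (fst y)) ` ?Y)" if "y' \<in> ?Y" for y'
      by (rule Max_ge) (use that in auto)
    ultimately show thesis
      by (intro that[of "fst y" "snd y"]) fastforce+
  qed
  have "(J_mat h *v (\<chi> l. v $ (i, l))) $ k \<le> 0"
    by (rule J_mat_nonpos_at_maximum) (use le m assms(3) in \<open>simp_all add: ik\<close>)
  moreover have "(J_mat h *v (\<chi> l. v $ (l, k))) $ i < 0"
  proof (rule J_mat_nonpos_at_maximum)
    show "(\<chi> l. v $ (l, k)) $ j < (\<chi> l. v $ (l, k)) $ i" if "pos i < pos j" for j
      using le[of "(j, k)"] far[of j k] that by (force simp: ik less_le)
  qed (use le m assms(3) in \<open>simp_all add: ik\<close>)
  ultimately have "(laplacian h *v v) $ (i, k) < 0"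
    by (simp add: laplacian_mult_vec)
  moreover have "0 \<le> s $ (i, k) * v $ (i, k)" using assms(2) m by (simp add: ik)
  moreover have "- (laplacian h *v v) $ (i, k) + s $ (i, k) * v $ (i, k) = 0"
    using arg_cong[OF assms(1), of "\<lambda>u. u $ (i, k)"] by simp
  ultimately show False by simp
qed

text \<open>The maximum principle applies to both \<open>v\<close> and \<open>- v\<close>.\<close>

lemma linearized_state_operator_inj:
  fixes v s :: "'m::{finite,linorder} gridfun"
  assumes "- (laplacian h *v v) + s * v = 0" "\<And>i. 0 \<le> s $ i" "0 < h"
  shows "v = 0"
proof -
  have "- (laplacian h *v (- v)) + s * (- v) = 0"
    using assms(1) linear_neg[OF matrix_vector_mul_linear, of "laplacian h" v]
    by (simp add: vec_eq_iff)
  then have "(- v) $ x \<le> 0" for x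
    using discrete_maximum_principle assms(2,3) by blast
  moreover have "v $ x \<le> 0" for x
    using discrete_maximum_principle assms by blast
  ultimately show ?thesis by (simp add: vec_eq_iff order_antisym)
qed

section \<open>Semismoothness of the residual\<close>

text \<open>A slanting function takes the slope at the moving point \<open>x\<close> instead of
  \<open>a\<close>. Exchanging the two costs \<open>(g' x - g' a) * (x - a)\<close>, which is of
  smaller order because \<open>g'\<close> is continuous at \<open>a\<close>.\<close>

lemma smallo_linearization_moving_slope:
  fixes g :: "real \<Rightarrow> real"
  assumes "(g has_field_derivative g' a) (at a)" "isCont g' a"
  shows "(\<lambda>x. g x - g a - g' x * (x - a)) \<in> o[nhds a](\<lambda>x. x - a)"
proof (rule landau_o.smallI)
  fix e :: real assume e: "0 < e"
  have "\<forall>e>0. \<exists>r>0. \<forall>x. norm (x - a) < r \<longrightarrow> norm (g x - g a - g' a * (x - a)) \<le> e * norm (x - a)"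
    using assms(1) unfolding has_field_derivative_def has_derivative_at_alt by blast
  then obtain r where r: "0 < r"
    "\<And>x. norm (x - a) < r \<Longrightarrow> norm (g x - g a - g' a * (x - a)) \<le> e / 2 * norm (x - a)"
    using e by (metis half_gt_zero)
  have "\<forall>\<^sub>F x in nhds a. dist x a < r"
    using r(1) eventually_nhds_metric by blast
  moreover have "\<forall>\<^sub>F x in nhds a. dist (g' x) (g' a) < e / 2"
    using assms(2) e unfolding continuous_at_eps_delta eventually_nhds_metric
    by (metis half_gt_zero)
  ultimately show "\<forall>\<^sub>F x in nhds a. norm (g x - g a - g' x * (x - a)) \<le> e * norm (x - a)"
  proof eventually_elim
    case (elim x)
    have "g x - g a - g' x * (x - a) = (g x - g a - g' a * (x - a)) - (g' x - g' a) * (x - a)"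
      by (simp add: algebra_simps)
    also have "norm \<dots> \<le> e / 2 * norm (x - a) + e / 2 * norm (x - a)"
    proof (rule norm_triangle_le_diff, rule add_mono)
      show "norm (g x - g a - g' a * (x - a)) \<le> e / 2 * norm (x - a)"
        using elim r(2)[of x] by (simp add: dist_norm)
      show "norm ((g' x - g' a) * (x - a)) \<le> e / 2 * norm (x - a)"
        unfolding norm_mult by (rule mult_right_mono) (use elim in \<open>simp_all add: dist_norm\<close>)
    qed
    finally show ?case by simp
  qed
qed

text \<open>The clamp is piecewise affine. Any \<open>v\<close> near \<open>v0\<close> shares a
  closed affine piece with \<open>v0\<close>, even if \<open>v0\<close> is a kink, and the slope is
  read off at \<open>v\<close>; so the remainder is exactly zero.\<close>

lemma clamp_linearization_exact:
  fixes a b v0 :: real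
  assumes "a \<le> b"
  shows "\<forall>\<^sub>F v in nhds v0.
    max a (min b v) - max a (min b v0) - (if a < v \<and> v < b then 1 else 0) * (v - v0) = 0"
proof -
  have lim: "((\<lambda>v. v) \<longlongrightarrow> v0) (nhds v0)" by (rule filterlim_ident)
  have "\<forall>\<^sub>F v in nhds v0. v0 < a \<longrightarrow> v < a" "\<forall>\<^sub>F v in nhds v0. v0 < b \<longrightarrow> v < b"
    "\<forall>\<^sub>F v in nhds v0. a < v0 \<longrightarrow> a < v" "\<forall>\<^sub>F v in nhds v0. b < v0 \<longrightarrow> b < v"
    using order_tendstoD[OF lim] by auto
  then show ?thesis
  proof eventually_elim
    case (elim v)
    then show ?case using assms by (auto simp: max_def min_def)
  qed
qed

lemma norm_in_smallo_vec:
  fixes f :: "'a \<Rightarrow> real ^ 'k::finite" and g :: "'a \<Rightarrow> real"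
  assumes "\<And>i. (\<lambda>w. f w $ i) \<in> o[F](g)"
  shows "(\<lambda>w. norm (f w)) \<in> o[F](g)"
proof -
  have "(\<lambda>w. \<Sum>i\<in>UNIV. \<bar>f w $ i\<bar>) \<in> o[F](g)"
    by (rule big_sum_in_smallo) (use assms in simp)
  moreover have "(\<lambda>w. norm (f w)) \<in> O[F](\<lambda>w. \<Sum>i\<in>UNIV. \<bar>f w $ i\<bar>)"
    by (rule bigoI[where c = 1]) (auto intro!: always_eventually order_trans[OF norm_le_l1_cart])
  ultimately show ?thesis by (rule landau_o.big_small_trans[rotated])
qed

lemma C_k_3_derivs:
  assumes "C_k 3 S"
  shows "(S has_field_derivative deriv S x) (at x)"
    and "(deriv S has_field_derivative deriv (deriv S) x) (at x)"
    and "isCont S x" and "isCont (deriv S) x" and "isCont (deriv (deriv S)) x"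
proof -
  have "\<forall>j<3. (deriv ^^ j) S differentiable at x" using assms by (simp add: C_k_def)
  then have "S differentiable at x" "deriv S differentiable at x" "deriv (deriv S) differentiable at x"
    by (auto simp: eval_nat_numeral All_less_Suc)
  then show "(S has_field_derivative deriv S x) (at x)"
    "(deriv S has_field_derivative deriv (deriv S) x) (at x)"
    "isCont S x" "isCont (deriv S) x" "isCont (deriv (deriv S)) x"
    by (auto simp: DERIV_deriv_iff_real_differentiable differentiable_imp_continuous_within)
qed

lemma minus_matrix_vector_mult: "(- A) *v v = - (A *v v)" for A :: "real ^ 'n ^ 'm"
  by (simp add: vec_eq_iff matrix_vector_mult_def sum_negf)

lemma slanting_G_mult_vec:
  "upper (slanting_G h \<alpha> ua ub S w *v v) =
    - (laplacian h *v upper v) + vmap (deriv S) (upper w) * upper v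
      - (1 / \<alpha>) *\<^sub>R (dPhi h ua ub ((1 / \<alpha>) *\<^sub>R lower w) * lower v)"
  "lower (slanting_G h \<alpha> ua ub S w *v v) =
    upper v + (vmap (deriv (deriv S)) (upper w) * lower w) * upper v
      - (laplacian h *v lower v) + vmap (deriv S) (upper w) * lower v"
  by (simp_all add: slanting_G_def Let_def block_mat_mult_vec matrix_vector_mult_add_rdistrib
      matrix_vector_mult_diff_rdistrib Psi_mult_vec scaleR_matrix_vector_assoc[symmetric]
      minus_matrix_vector_mult)

lemma upper_lower_residual_F:
  "upper (residual_F h \<alpha> ua ub f yd S z) = - (laplacian h *v upper z) + vmap S (upper z)
    - Phi h ua ub ((1/\<alpha>) *\<^sub>R lower z) - grid_values h f"
  "lower (residual_F h \<alpha> ua ub f yd S z) = - (laplacian h *v lower z)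
    + vmap (deriv S) (upper z) * lower z + upper z - grid_values h yd"
  by (simp_all add: residual_F_def Let_def)

lemma vec_nth_Inl_Inr: "v $ Inl i = upper v $ i" "v $ Inr i = lower v $ i"
  by (simp_all add: upper_def lower_def)

lemma tendsto_upper_lower_nth:
  "((\<lambda>w. upper w $ i) \<longlongrightarrow> upper x $ i) (nhds x)" "((\<lambda>w. lower w $ i) \<longlongrightarrow> lower x $ i) (nhds x)"
  unfolding upper_def lower_def vec_lambda_beta
  by (intro tendsto_vec_nth filterlim_ident)+

lemma semismooth_residual_F:
  fixes x :: "'m::{finite,linorder} pairfun"
  assumes S: "C_k 3 S" and \<alpha>: "0 < \<alpha>"
    and bounds: "\<And>i :: 'm node. ua (grid_point h i) \<le> ub (grid_point h i)"
  shows "(\<lambda>w. norm (residual_F h \<alpha> ua ub f yd S w - residual_F h \<alpha> ua ub f yd S x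
    - slanting_G h \<alpha> ua ub S w *v (w - x))) \<in> o[nhds x](\<lambda>w. norm (w - x))"
proof (rule norm_in_smallo_vec)
  fix k :: "'m node + 'm node"
  let ?o = "o[nhds x](\<lambda>w. norm (w - x))"
  have Y: "(\<lambda>w. upper w $ i - upper x $ i) \<in> O[nhds x](\<lambda>w. norm (w - x))" for i
  proof (rule bigoI[where c = 1], rule always_eventually, rule allI)
    show "norm (upper w $ i - upper x $ i) \<le> 1 * norm (norm (w - x))" for w
      using component_le_norm_cart[of "w - x" "Inl i"] by (simp add: upper_def)
  qed
  have P: "(\<lambda>w. lower w $ i - lower x $ i) \<in> O[nhds x](\<lambda>w. norm (w - x))" for i
  proof (rule bigoI[where c = 1], rule always_eventually, rule allI)
    show "norm (lower w $ i - lower x $ i) \<le> 1 * norm (norm (w - x))" for w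
      using component_le_norm_cart[of "w - x" "Inr i"] by (simp add: lower_def)
  qed
  have lin: "(\<lambda>w. g (upper w $ i) - g (upper x $ i) - g' (upper w $ i) * (upper w $ i - upper x $ i)) \<in> ?o"
    if "(g has_field_derivative g' (upper x $ i)) (at (upper x $ i))" "isCont g' (upper x $ i)"
    for g g' :: "real \<Rightarrow> real" and i
    using landau_o.small.compose[OF smallo_linearization_moving_slope[OF that] tendsto_upper_lower_nth(1)] Y
    by (rule landau_o.small_big_trans)
  show "(\<lambda>w. (residual_F h \<alpha> ua ub f yd S w - residual_F h \<alpha> ua ub f yd S x
    - slanting_G h \<alpha> ua ub S w *v (w - x)) $ k) \<in> ?o"
  proof (cases k)
    case (Inl i)
    let ?a = "ua (grid_point h i)" and ?b = "ub (grid_point h i)"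
    have "((\<lambda>w. lower w $ i / \<alpha>) \<longlongrightarrow> lower x $ i / \<alpha>) (nhds x)"
      using \<alpha> by (intro tendsto_divide tendsto_upper_lower_nth tendsto_const) simp
    \<comment> \<open>Near \<open>x\<close> the clamp leaves no remainder and the Laplacian is
      linear, so only the linearisation error of \<open>S\<close> survives.\<close>
    from eventually_compose_filterlim[OF clamp_linearization_exact[OF bounds[of i]] this]
    have "\<forall>\<^sub>F w in nhds x. (residual_F h \<alpha> ua ub f yd S w - residual_F h \<alpha> ua ub f yd S x
        - slanting_G h \<alpha> ua ub S w *v (w - x)) $ k =
      S (upper w $ i) - S (upper x $ i) - deriv S (upper w $ i) * (upper w $ i - upper x $ i)"
    proof eventually_elim
      case (elim w)
      then show ?case
        by (simp add: Inl vec_nth_Inl_Inr upper_lower_residual_F slanting_G_mult_vec vmap_def Phi_def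
            dPhi_def matrix_vector_mult_diff_distrib algebra_simps diff_divide_distrib split: if_splits)
    qed
    then show ?thesis
      using lin[OF C_k_3_derivs(1,4)[OF S]] by (subst landau_o.small.in_cong)
  next
    case (Inr i)
    \<comment> \<open>The product \<open>deriv S y * p\<close> leaves two errors: that of
      \<open>deriv S\<close>, scaled by the fixed value \<open>?p x\<close>, and a mixed term in
      which the increments of \<open>y\<close> and \<open>p\<close> are multiplied, hence of second
      order.\<close>
    let ?y = "\<lambda>w. upper w $ i" and ?p = "\<lambda>w. lower w $ i"
    have "(\<lambda>w. deriv (deriv S) (?y w) * (?p w - ?p x)) \<in> O[nhds x](\<lambda>w. norm (w - x))"
    proof -
      have "((\<lambda>w. deriv (deriv S) (?y w)) \<longlongrightarrow> deriv (deriv S) (?y x)) (nhds x)"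
        by (intro isCont_tendsto_compose[OF C_k_3_derivs(5)[OF S]] tendsto_upper_lower_nth)
      then have "(\<lambda>w. deriv (deriv S) (?y w)) \<in> O[nhds x](\<lambda>_. 1)"
        by (intro bigoI_tendsto[where c = "deriv (deriv S) (?y x)"]) simp_all
      from landau_o.big.mult[OF this P[of i]] show ?thesis by simp
    qed
    moreover have "(\<lambda>w. ?y w - ?y x) \<in> o[nhds x](\<lambda>_. 1)"
      using LIM_zero[OF tendsto_upper_lower_nth(1)[of i x]] by (intro smalloI_tendsto) simp_all
    ultimately have "(\<lambda>w. deriv (deriv S) (?y w) * (?p w - ?p x) * (?y w - ?y x)) \<in> ?o"
      using landau_o.big_small_mult by fastforce
    moreover have "(\<lambda>w. ?p x * (deriv S (?y w) - deriv S (?y x)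
        - deriv (deriv S) (?y w) * (?y w - ?y x))) \<in> ?o"
      using lin[OF C_k_3_derivs(2,5)[OF S]] by (cases "?p x = 0") simp_all
    ultimately have "(\<lambda>w. ?p x * (deriv S (?y w) - deriv S (?y x)
        - deriv (deriv S) (?y w) * (?y w - ?y x))
        - deriv (deriv S) (?y w) * (?p w - ?p x) * (?y w - ?y x)) \<in> ?o"
      by (rule sum_in_smallo(2)[rotated])
    moreover have "?p x * (deriv S (?y w) - deriv S (?y x) - deriv (deriv S) (?y w) * (?y w - ?y x))
        - deriv (deriv S) (?y w) * (?p w - ?p x) * (?y w - ?y x) =
      (residual_F h \<alpha> ua ub f yd S w - residual_F h \<alpha> ua ub f yd S x
        - slanting_G h \<alpha> ua ub S w *v (w - x)) $ k" for w
      by (simp add: Inr vec_nth_Inl_Inr upper_lower_residual_F slanting_G_mult_vec vmap_def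
          matrix_vector_mult_diff_distrib algebra_simps)
    ultimately show ?thesis by simp
  qed
qed

lemma isCont_residual_F:
  assumes S: "C_k 3 S" and \<alpha>: "0 < \<alpha>"
  shows "isCont (residual_F h \<alpha> ua ub f yd S) x"
proof -
  let ?F = "residual_F h \<alpha> ua ub f yd S"
  have mat: "((\<lambda>w. (A *v upper w) $ i) \<longlongrightarrow> (A *v upper x) $ i) (nhds x)"
    "((\<lambda>w. (A *v lower w) $ i) \<longlongrightarrow> (A *v lower x) $ i) (nhds x)"
    for A :: "real ^ _ ^ _" and i
    unfolding matrix_vector_mult_def vec_lambda_beta
    by (intro tendsto_sum tendsto_mult tendsto_const tendsto_upper_lower_nth)+
  have "(?F \<longlongrightarrow> ?F x) (nhds x)"
  proof (rule vec_tendstoI)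
    fix k
    show "((\<lambda>w. ?F w $ k) \<longlongrightarrow> ?F x $ k) (nhds x)"
    proof (cases k)
      case (Inl i)
      show ?thesis
        by (simp add: Inl vec_nth_Inl_Inr upper_lower_residual_F vmap_def Phi_def)
          (intro tendsto_add tendsto_diff tendsto_minus tendsto_mult tendsto_divide tendsto_max
            tendsto_min tendsto_const mat tendsto_upper_lower_nth isCont_tendsto_compose[OF C_k_3_derivs(3)[OF S]]; use \<alpha> in simp)
    next
      case (Inr i)
      show ?thesis
        by (simp add: Inr vec_nth_Inl_Inr upper_lower_residual_F vmap_def)
          (intro tendsto_add tendsto_diff tendsto_minus tendsto_mult tendsto_divide tendsto_max
            tendsto_min tendsto_const mat tendsto_upper_lower_nth isCont_tendsto_compose[OF C_k_3_derivs(4)[OF S]])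
    qed
  qed
  then show ?thesis by (simp add: continuous_at tendsto_at_iff_tendsto_nhds)
qed

section \<open>Norm minimisers and inexact Newton steps\<close>

text \<open>
  Only an upper bound for the slope is required to converge, since the slanting function itself
  may be discontinuous at the minimiser.
\<close>

lemma slope_bound_nonneg_at_norm_minimizer:
  fixes F :: "'a::real_normed_vector \<Rightarrow> 'b::real_inner" and H :: "'a \<Rightarrow> 'a \<Rightarrow> 'b"
  assumes min: "\<And>w. norm (F x) \<le> norm (F w)"
    and slant: "(\<lambda>w. norm (F w - F x - H w (w - x))) \<in> o[nhds x](\<lambda>w. norm (w - x))"
    and hom: "\<And>w t. H w (t *\<^sub>R d) = t *\<^sub>R H w d"
    and bdd: "\<forall>\<^sub>F w in nhds x. norm (H w d) \<le> B"
    and le: "\<And>w. F x \<bullet> H w d \<le> u w"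
    and u: "(u \<longlongrightarrow> u0) (nhds x)"
  shows "0 \<le> u0"
proof (rule ccontr)
  assume "\<not> 0 \<le> u0"
  then have u0: "u0 < 0" by simp
  \<comment> \<open>The summand 1 keeps \<open>c\<close> positive even for \<open>d = 0\<close>.
    With this \<open>e\<close> the linearisation error adds at most \<open>- u0 / 8\<close> to the
    slope \<open>F x \<bullet> q\<close>.\<close>
  define c where "c = norm (F x) * norm d + 1"
  define e where "e = - u0 / 8 / c"
  have c: "0 < c" unfolding c_def by (intro add_nonneg_pos) simp_all
  then have e: "0 < e" using u0 unfolding e_def by (intro divide_pos_pos) simp_all
  have "e * c = - u0 / 8" unfolding e_def using c by simp
  then have e': "norm (F x) * (e * norm d) \<le> - u0 / 8"
    using e by (simp add: c_def algebra_simps)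
  define B' where "B' = B + e * norm d"
  have ray: "((\<lambda>t. x + t *\<^sub>R d) \<longlongrightarrow> x) (at_right 0)"
    by (rule tendsto_eq_intros | simp)+
  have "\<forall>\<^sub>F w in nhds x. norm (F w - F x - H w (w - x)) \<le> e * norm (w - x)"
    using landau_o.smallD[OF slant e] by simp
  from eventually_compose_filterlim[OF this ray]
  have "\<forall>\<^sub>F t in at_right 0. norm (F (x + t *\<^sub>R d) - F x - H (x + t *\<^sub>R d) (t *\<^sub>R d)) \<le> e * norm (t *\<^sub>R d)"
    by simp
  moreover have "\<forall>\<^sub>F t in at_right 0. norm (H (x + t *\<^sub>R d) d) \<le> B"
    by (rule eventually_compose_filterlim[OF bdd ray])
  moreover have "\<forall>\<^sub>F t in at_right 0. u (x + t *\<^sub>R d) < u0 / 2"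
    by (rule eventually_compose_filterlim[OF order_tendstoD(2)[OF u] ray]) (use u0 in simp)
  moreover have "\<forall>\<^sub>F t in at_right 0. t * B'\<^sup>2 < - u0 / 4"
  proof -
    have "((\<lambda>t. t * B'\<^sup>2) \<longlongrightarrow> 0) (at_right 0)" by (auto intro!: tendsto_eq_intros)
    then show ?thesis by (rule order_tendstoD) (use u0 in simp)
  qed
  moreover have "\<forall>\<^sub>F t :: real in at_right 0. 0 < t"
    by (simp add: eventually_at_right_less)
  ultimately have "\<forall>\<^sub>F t :: real in at_right 0. False"
  proof eventually_elim
    case (elim t)
    define w where "w = x + t *\<^sub>R d"
    define q where "q = (1 / t) *\<^sub>R (F w - F x)"
    define \<rho> where "\<rho> = (1 / t) *\<^sub>R (F w - F x - H w (t *\<^sub>R d))"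
    have t: "0 < t" using elim by simp
    have Fw: "F w = F x + t *\<^sub>R q" using t by (simp add: q_def)
    have q: "q = H w d + \<rho>" using t by (simp add: q_def \<rho>_def hom algebra_simps)
    have "norm \<rho> = norm (F w - F x - H w (t *\<^sub>R d)) / t" using t by (simp add: \<rho>_def)
    also have "\<dots> \<le> e * norm (t *\<^sub>R d) / t"
      by (rule divide_right_mono) (use elim t in \<open>simp_all add: w_def\<close>)
    finally have \<rho>: "norm \<rho> \<le> e * norm d" using t by simp
    have "F x \<bullet> \<rho> \<le> norm (F x) * norm \<rho>" by (rule norm_cauchy_schwarz)
    also have "\<dots> \<le> norm (F x) * (e * norm d)" by (rule mult_left_mono[OF \<rho>]) simp
    finally have "F x \<bullet> \<rho> \<le> - u0 / 8" using e' by simp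
    moreover have "F x \<bullet> H w d < u0 / 2" using le[of w] elim by (simp add: w_def)
    ultimately have inner: "F x \<bullet> q < u0 / 2 - u0 / 8" by (simp add: q inner_add_right)
    have "norm q \<le> B'"
      unfolding q B'_def by (rule norm_triangle_le, rule add_mono) (use elim \<rho> in \<open>simp_all add: w_def\<close>)
    then have "(norm q)\<^sup>2 \<le> B'\<^sup>2" by (rule power_mono) simp
    then have "t * (norm q)\<^sup>2 \<le> t * B'\<^sup>2" by (rule mult_left_mono) (use t in simp)
    \<comment> \<open>The slope is below \<open>3 * u0 / 8\<close> and the quadratic term below
      \<open>- u0 / 4\<close>, so the sum is below \<open>u0 / 2\<close>. Hence a short step along
      \<open>d\<close> would lower the norm, against minimality.\<close>
    then have "2 * (F x \<bullet> q) + t * (norm q)\<^sup>2 < 0" using inner elim u0 by linarith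
    then have "t * (2 * (F x \<bullet> q) + t * (norm q)\<^sup>2) < 0" using t by (simp add: mult_less_0_iff)
    moreover have "(norm (F w))\<^sup>2 = (norm (F x))\<^sup>2 + t * (2 * (F x \<bullet> q) + t * (norm q)\<^sup>2)"
      unfolding Fw power2_norm_eq_inner
      by (simp add: inner_add_left inner_add_right inner_commute algebra_simps)
    moreover have "(norm (F x))\<^sup>2 \<le> (norm (F w))\<^sup>2" by (intro power_mono min) simp
    ultimately show False by simp
  qed
  then show False by (simp add: trivial_limit_at_right_real)
qed

text \<open>The new error satisfies
  \<open>H w (w + v - x) = (F w + H w v) - (F w - H w (w - x))\<close>: inexactness of the linear
  solve minus the linearisation error. The bounds on \<open>H w\<close> are asked only at the point
  \<open>w\<close>, because the application supplies them at the iterates.\<close>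

lemma inexact_newton_step_contraction:
  fixes F :: "'a::real_normed_vector \<Rightarrow> 'b::real_normed_vector" and H :: "'a \<Rightarrow> 'a \<Rightarrow> 'b"
  assumes zero: "F x = 0"
    and slant: "(\<lambda>w. norm (F w - F x - H w (w - x))) \<in> o[nhds x](\<lambda>w. norm (w - x))"
    and M: "0 < M"
  obtains \<rho> e where "0 < \<rho>" "0 < e"
    "\<And>w v. norm (w - x) < \<rho> \<Longrightarrow> linear (H w) \<Longrightarrow> (\<And>v. norm (H w v) \<le> M * norm v) \<Longrightarrow>
      (\<And>v. norm v \<le> M * norm (H w v)) \<Longrightarrow> norm (F w + H w v) \<le> e * norm (F w) \<Longrightarrow>
      norm (w + v - x) \<le> norm (w - x) / 2"
proof -
  \<comment> \<open>Each of the two error sources may contribute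
    \<open>norm (w - x) / (4 * M)\<close>. Inverting \<open>H w\<close> costs a factor
    \<open>M\<close>, which leaves one half in total. The factor \<open>M + \<epsilon>\<close> in
    \<open>e\<close> bounds \<open>norm (F w)\<close> by the distance to \<open>x\<close>.\<close>
  define \<epsilon> where "\<epsilon> = 1 / (4 * M)"
  define e where "e = 1 / (4 * M * (M + \<epsilon>))"
  have \<epsilon>: "0 < \<epsilon>" using M by (simp add: \<epsilon>_def)
  then have e: "0 < e" using M by (simp add: e_def)
  have "\<forall>\<^sub>F w in nhds x. norm (F w - F x - H w (w - x)) \<le> \<epsilon> * norm (w - x)"
    using landau_o.smallD[OF slant \<epsilon>] by simp
  then obtain \<rho> where \<rho>: "0 < \<rho>"
    "\<And>w. norm (w - x) < \<rho> \<Longrightarrow> norm (F w - H w (w - x)) \<le> \<epsilon> * norm (w - x)"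
    unfolding eventually_nhds_metric by (auto simp: dist_norm zero)
  show thesis
  proof (rule that[OF \<rho>(1) e])
    fix w v
    assume w: "norm (w - x) < \<rho>" and lin: "linear (H w)"
      and upper: "\<And>v. norm (H w v) \<le> M * norm v" and lower: "\<And>v. norm v \<le> M * norm (H w v)"
      and res: "norm (F w + H w v) \<le> e * norm (F w)"
    have "norm (F w) \<le> norm (F w - H w (w - x)) + norm (H w (w - x))"
      using norm_triangle_ineq[of "F w - H w (w - x)" "H w (w - x)"] by simp
    also have "\<dots> \<le> (M + \<epsilon>) * norm (w - x)"
      using \<rho>(2)[OF w] upper[of "w - x"] by (simp add: algebra_simps)
    finally have "e * norm (F w) \<le> e * ((M + \<epsilon>) * norm (w - x))" using e by simp
    also have "\<dots> = norm (w - x) / (4 * M)"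
      unfolding e_def using M \<epsilon> add_pos_pos[OF M \<epsilon>] by simp
    finally have Fw: "e * norm (F w) \<le> norm (w - x) / (4 * M)" .
    have "w + v - x = (w - x) + v" by simp
    then have "H w (w + v - x) = H w (w - x) + H w v" by (simp only: linear_add[OF lin])
    also have "\<dots> = (F w + H w v) - (F w - H w (w - x))" by simp
    also have "norm \<dots> \<le> norm (w - x) / (4 * M) + \<epsilon> * norm (w - x)"
      by (rule norm_triangle_le_diff, rule add_mono) (use res Fw \<rho>(2)[OF w] in simp_all)
    also have "\<dots> = norm (w - x) / (2 * M)" by (simp add: \<epsilon>_def)
    finally have "M * norm (H w (w + v - x)) \<le> M * (norm (w - x) / (2 * M))"
      by (rule mult_left_mono) (use M in simp)
    also have "\<dots> = norm (w - x) / 2" using M by simp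
    finally show "norm (w + v - x) \<le> norm (w - x) / 2"
      using lower[of "w + v - x"] by simp
  qed
qed

text \<open>One sufficiently late iterate of the subsequence inside the ball is enough: from there
  on, halving keeps every iterate of the full sequence inside and gives geometric decay.\<close>

lemma converges_to_attracting_limit_point:
  fixes z :: "nat \<Rightarrow> 'a::metric_space"
  assumes \<rho>: "0 < \<rho>"
    and step: "\<And>k. K \<le> k \<Longrightarrow> dist (z k) x < \<rho> \<Longrightarrow> dist (z (Suc k)) x \<le> dist (z k) x / 2"
    and r: "strict_mono r" "(z \<circ> r) \<longlonglongrightarrow> x"
  shows "z \<longlonglongrightarrow> x"
proof -
  have "\<forall>\<^sub>F j in sequentially. dist ((z \<circ> r) j) x < \<rho> \<and> K \<le> j"
    using tendstoD[OF r(2) \<rho>] eventually_ge_at_top by (rule eventually_conj)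
  then obtain j where j: "dist (z (r j)) x < \<rho>" "K \<le> r j"
    using seq_suble[OF r(1)] by (auto simp: eventually_sequentially intro: order_trans)
  have *: "dist (z (i + r j)) x \<le> dist (z (r j)) x * (1 / 2) ^ i" for i
  proof (induction i)
    case (Suc i)
    \<comment> \<open>The geometric bound also keeps the iterate in the ball, so that
      \<open>step\<close> applies again.\<close>
    have "dist (z (r j)) x * (1 / 2) ^ i \<le> dist (z (r j)) x"
      by (simp add: mult_left_le power_le_one)
    then have "dist (z (i + r j)) x < \<rho>" using Suc j by simp
    then have "dist (z (Suc (i + r j))) x \<le> dist (z (i + r j)) x / 2"
      using j by (intro step) simp_all
    then show ?case using Suc by simp
  qed simp
  have "(\<lambda>i. dist (z (r j)) x * (1 / 2) ^ i) \<longlonglongrightarrow> dist (z (r j)) x * 0"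
    by (intro tendsto_mult tendsto_const LIMSEQ_power_zero) simp
  then have lim: "(\<lambda>i. dist (z (r j)) x * (1 / 2) ^ i) \<longlonglongrightarrow> 0"
    by (simp only: mult_zero_right)
  have "(\<lambda>i. dist (z (i + r j)) x) \<longlonglongrightarrow> 0"
    by (rule real_tendsto_sandwich[OF always_eventually always_eventually tendsto_const lim])
      (rule allI, rule zero_le_dist, rule allI, rule *)
  then have "(\<lambda>i. z (i + r j)) \<longlonglongrightarrow> x" by (rule tendsto_dist_iff[THEN iffD2])
  then show ?thesis by (rule LIMSEQ_offset)
qed

section \<open>Minimisers of the residual are zeros\<close>

lemma norm_vec_mult_le:
  fixes v w :: "real ^ 'k::finite"
  assumes "\<And>i. \<bar>v $ i\<bar> \<le> 1"
  shows "norm (v * w) \<le> norm w"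
  by (rule norm_le_componentwise_cart) (use assms in \<open>simp add: abs_mult mult_left_le_one_le\<close>)

lemma norm_stack_le: "norm (stack v w) \<le> norm v + norm w"
  by (rule norm_le_square[THEN iffD2])
    (simp add: norm_eq_square inner_upper_lower power2_sum flip: power2_norm_eq_inner)

lemma residual_F_zero_at_minimizer:
  fixes x :: "'m::{finite,linorder} pairfun"
  assumes S: "C_k 3 S" and mono: "\<And>y. 0 \<le> deriv S y" and \<alpha>: "0 < \<alpha>" and h: "0 < h"
    and bounds: "\<And>i :: 'm node. ua (grid_point h i) \<le> ub (grid_point h i)"
    and coercive: "\<And>i. 0 < deriv (deriv S) (upper x $ i) * lower x $ i + 1"
    and min: "\<And>w :: 'm pairfun. norm (residual_F h \<alpha> ua ub f yd S x) \<le> norm (residual_F h \<alpha> ua ub f yd S w)"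
  shows "residual_F h \<alpha> ua ub f yd S x = 0"
proof -
  let ?F = "residual_F h \<alpha> ua ub f yd S :: 'm pairfun \<Rightarrow> 'm pairfun"
  let ?G = "slanting_G h \<alpha> ua ub S :: 'm pairfun \<Rightarrow> 'm pairmat"
  define r1 r2 where "r1 = upper (?F x)" and "r2 = lower (?F x)"
  define A where "A w v = - (laplacian h *v v) + vmap (deriv S) (upper w) * v" for w :: "'m pairfun" and v
  define C where "C w v = v + (vmap (deriv (deriv S)) (upper w) * lower w) * v" for w :: "'m pairfun" and v
  have slant: "(\<lambda>w. norm (?F w - ?F x - ?G w *v (w - x))) \<in> o[nhds x](\<lambda>w. norm (w - x))"
    by (rule semismooth_residual_F[where ua = ua and ub = ub and h = h, OF S \<alpha> bounds])
  have A_lim: "((\<lambda>w. A w v) \<longlongrightarrow> A x v) (nhds x)" for v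
    by (rule vec_tendstoI) (simp add: A_def vmap_def, intro tendsto_add tendsto_diff tendsto_mult tendsto_const
        tendsto_minus isCont_tendsto_compose[OF C_k_3_derivs(4)[OF S]] tendsto_upper_lower_nth)
  have C_lim: "((\<lambda>w. C w v) \<longlongrightarrow> C x v) (nhds x)" for v
    by (rule vec_tendstoI) (simp add: C_def vmap_def, intro tendsto_add tendsto_diff tendsto_mult tendsto_const
        isCont_tendsto_compose[OF C_k_3_derivs(5)[OF S]] tendsto_upper_lower_nth)
  have A_sym: "A w v \<bullet> v' = v \<bullet> A w v'" for w v v'
  proof -
    have "(s * v) \<bullet> v' = v \<bullet> (s * v')" for s :: "'m gridfun"
      by (simp add: inner_vec_def algebra_simps)
    then show ?thesis
      by (simp add: A_def inner_diff_left inner_diff_right symmetric_laplacian)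
  qed
  \<comment> \<open>Since \<open>?F\<close> may have a kink at \<open>x\<close>, minimality is used
    through one-sided slopes in the direction \<open>stack y (c *\<^sub>R r1)\<close>. The case
    \<open>c = 0\<close> yields the adjoint equation, and \<open>y = 0\<close>, \<open>c = 1\<close>
    the sign of \<open>r2 \<bullet> A x r1\<close>.\<close>
  have first_order: "0 \<le> r1 \<bullet> A x y + r2 \<bullet> C x y + c * (r2 \<bullet> A x r1)" if "0 \<le> c" for y c
  proof (rule slope_bound_nonneg_at_norm_minimizer
      [where x = x and F = ?F and H = "\<lambda>w. (*v) (?G w)" and d = "stack y (c *\<^sub>R r1)", OF min slant])
    let ?d = "stack y (c *\<^sub>R r1)"
    let ?D = "\<lambda>w. dPhi h ua ub ((1 / \<alpha>) *\<^sub>R lower w) :: 'm gridfun"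
    have Gd: "upper (?G w *v ?d) = A w y - (c / \<alpha>) *\<^sub>R (?D w * r1)"
      "lower (?G w *v ?d) = C w y + c *\<^sub>R A w r1" for w
      by (simp_all add: slanting_G_mult_vec A_def C_def vec_eq_iff algebra_simps vec.scale)
    show "?G w *v (t *\<^sub>R ?d) = t *\<^sub>R (?G w *v ?d)" for w t
      by (simp add: matrix_vector_mult_scaleR)
    have "((\<lambda>w. norm (A w y) + norm (C w y + c *\<^sub>R A w r1)) \<longlongrightarrow>
        norm (A x y) + norm (C x y + c *\<^sub>R A x r1)) (nhds x)"
      by (intro tendsto_intros A_lim C_lim)
    then have "\<forall>\<^sub>F w in nhds x. norm (A w y) + norm (C w y + c *\<^sub>R A w r1)
        < norm (A x y) + norm (C x y + c *\<^sub>R A x r1) + 1"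
      by (rule order_tendstoD) simp
    \<comment> \<open>The term with \<open>?D\<close> need not converge, but its entries are 0 or 1,
      so it stays bounded; the other terms converge and the 1 is slack.\<close>
    then show "\<forall>\<^sub>F w in nhds x. norm (?G w *v ?d) \<le>
        norm (A x y) + norm (C x y + c *\<^sub>R A x r1) + 1 + c / \<alpha> * norm r1"
    proof eventually_elim
      case (elim w)
      have "norm (?G w *v ?d) \<le> norm (upper (?G w *v ?d)) + norm (lower (?G w *v ?d))"
        using norm_stack_le[of "upper (?G w *v ?d)" "lower (?G w *v ?d)"] by simp
      also have "norm (upper (?G w *v ?d)) \<le> norm (A w y) + c / \<alpha> * norm r1"
      proof -
        have "norm (?D w * r1) \<le> norm r1" by (rule norm_vec_mult_le) (simp add: dPhi_def)
        then have "norm ((c / \<alpha>) *\<^sub>R (?D w * r1)) \<le> c / \<alpha> * norm r1"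
          using that \<alpha> by (simp add: mult_left_mono divide_right_mono)
        then show ?thesis unfolding Gd by (intro norm_triangle_le_diff) simp
      qed
      finally show ?case using elim unfolding Gd by simp
    qed
    \<comment> \<open>The clamp contributes
      \<open>- (c / \<alpha>) * (r1 \<bullet> (?D w * r1))\<close>, which is nonpositive because the
      \<open>p\<close>-direction is a nonnegative multiple of \<open>r1\<close>. Dropping it leaves
      a continuous upper bound.\<close>
    show "?F x \<bullet> (?G w *v ?d) \<le> r1 \<bullet> A w y + r2 \<bullet> C w y + c * (r2 \<bullet> A w r1)" for w
    proof -
      have "0 \<le> r1 \<bullet> (?D w * r1)"
        unfolding inner_vec_def by (rule sum_nonneg) (simp add: dPhi_def)
      then have "0 \<le> c / \<alpha> * (r1 \<bullet> (?D w * r1))" using that \<alpha> by simp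
      then show ?thesis
        by (simp add: inner_upper_lower[of "?F x"] Gd inner_diff_right inner_add_right flip: r1_def r2_def)
    qed
    show "((\<lambda>w. r1 \<bullet> A w y + r2 \<bullet> C w y + c * (r2 \<bullet> A w r1)) \<longlongrightarrow>
        r1 \<bullet> A x y + r2 \<bullet> C x y + c * (r2 \<bullet> A x r1)) (nhds x)"
      by (intro tendsto_intros A_lim C_lim)
  qed
  have C_sym: "r2 \<bullet> C x v = C x r2 \<bullet> v" for v
    by (simp add: C_def inner_vec_def algebra_simps)
  have "0 \<le> (A x r1 + C x r2) \<bullet> y" for y
    using first_order[of 0 y] by (simp add: A_sym[symmetric] C_sym inner_add_left)
  from this[of "- (A x r1 + C x r2)"] have adj: "A x r1 + C x r2 = 0"
    by (metis inner_minus_right neg_0_le_iff_le inner_ge_zero inner_eq_zero_iff order_antisym)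
  have "0 \<le> r2 \<bullet> A x r1"
    using first_order[of 1 0] by (simp add: A_def C_def)
  \<comment> \<open>The adjoint equation gives \<open>C x r2 = - A x r1\<close>.\<close>
  then have "r2 \<bullet> C x r2 \<le> 0"
    using adj by (simp add: eq_neg_iff_add_eq_0[symmetric])
  moreover have "r2 \<bullet> C x r2 = (\<Sum>i\<in>UNIV. (deriv (deriv S) (upper x $ i) * lower x $ i + 1) * (r2 $ i)\<^sup>2)"
    by (simp add: inner_vec_def C_def vmap_def power2_eq_square algebra_simps)
  moreover have nonneg: "0 \<le> (deriv (deriv S) (upper x $ i) * lower x $ i + 1) * (r2 $ i)\<^sup>2" for i
    using coercive[of i] by simp
  ultimately have "(\<Sum>i\<in>UNIV. (deriv (deriv S) (upper x $ i) * lower x $ i + 1) * (r2 $ i)\<^sup>2) = 0"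
    by (simp add: order_antisym sum_nonneg)
  then have "(deriv (deriv S) (upper x $ i) * lower x $ i + 1) * (r2 $ i)\<^sup>2 = 0" for i
    using nonneg by (simp add: sum_nonneg_eq_0_iff del: split_paired_All)
  then have "r2 $ i = 0" for i using coercive[of i]
    by (metis less_irrefl mult_eq_0_iff power_eq_0_iff)
  then have r2: "r2 = 0" by (simp add: vec_eq_iff)
  then have "A x r1 = 0" using adj by (simp add: C_def)
  then have "r1 = 0"
    unfolding A_def by (rule linearized_state_operator_inj) (use mono h in \<open>simp_all add: vmap_def\<close>)
  moreover have "?F x = stack r1 r2" by (simp add: r1_def r2_def)
  ultimately show ?thesis using r2 by (auto simp: stack_def vec_eq_iff split: sum.split)
qed

section \<open>Convergence\<close>

text \<open>Positions run from 1 to \<open>n - 1\<close>. This makes the ordering of the bounds,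
  assumed on \<open>Omega\<close>, available at the nodes.\<close>

lemma grid_point_in_Omega:
  fixes i :: "'m::{finite,linorder} node"
  assumes "2 \<le> n" "CARD('m) = n - 1"
  shows "grid_point (1 / real n) i \<in> Omega"
proof -
  have "0 < pos (j :: 'm)" "pos j < n" for j :: 'm
    using pos_bounds[of j] assms by auto
  then show ?thesis
    using assms by (auto simp: grid_point_def Omega_def divide_less_eq split: prod.split)
qed

lemma matrix_inv_mult_self:
  assumes "invertible A"
  shows "matrix_inv A ** A = mat 1"
  using someI_ex[OF assms[unfolded invertible_def]] by (simp add: matrix_inv_def)

text \<open>Up to the factor \<open>h\<^sup>2\<close>, with \<open>a\<close> the initial residual
  norm, the reference value is at least \<open>a\<^sup>2 / 2\<close>. The slope term takes away at
  most \<open>(norm ?f)\<^sup>2\<close>, hence at most \<open>a\<^sup>2 / 4\<close>, as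
  \<open>c1 \<le> 1 / 2\<close> and \<open>norm ?g \<le> 2 * norm ?f\<close>. The new merit is at
  most \<open>a\<^sup>2 / 8\<close>.\<close>

lemma full_step_accepted_near_zero:
  fixes F :: "'m::{finite,linorder} pairfun \<Rightarrow> 'm pairfun"
  assumes h: "0 < h" and c1: "0 < c1" "c1 \<le> 1 / 2"
    and res: "norm (F (z k) + G (z k) *v d) \<le> norm (F (z k))"
    and small: "norm (F (z k)) \<le> norm (F (z 0)) / 2" "norm (F (z k + d)) \<le> norm (F (z 0)) / 2"
  shows "step_accepted h F G c1 z d k 1"
proof -
  define a where "a = norm (F (z 0))"
  let ?f = "F (z k)" and ?g = "G (z k) *v d"
  have merit: "merit h F w = h\<^sup>2 * ((norm (F w))\<^sup>2 / 2)" for w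
    using h by (simp add: merit_def dnorm_eq_norm power_mult_distrib)
  have grad: "grad_merit F G (z k) \<bullet> d = ?f \<bullet> ?g"
    unfolding grad_merit_def
    using dot_lmul_matrix[of ?f "G (z k)" d] transpose_matrix_vector[of "G (z k)" ?f] by simp
  have "norm ?g \<le> norm (?f + ?g) + norm ?f"
    using norm_triangle_ineq4[of "?f + ?g" ?f] by simp
  then have "norm ?g \<le> 2 * norm ?f" using res by simp
  then have "norm ?f * norm ?g \<le> 2 * (norm ?f)\<^sup>2"
    using mult_left_mono[of "norm ?g" "2 * norm ?f" "norm ?f"] by (simp add: power2_eq_square)
  then have "- (2 * (norm ?f)\<^sup>2) \<le> ?f \<bullet> ?g"
    using Cauchy_Schwarz_ineq2[of ?f ?g] by linarith
  then have "c1 * - (2 * (norm ?f)\<^sup>2) \<le> c1 * (?f \<bullet> ?g)"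
    by (rule mult_left_mono) (use c1 in simp)
  moreover have "c1 * (2 * (norm ?f)\<^sup>2) \<le> 1 / 2 * (2 * (norm ?f)\<^sup>2)"
    by (rule mult_right_mono) (use c1 in simp_all)
  moreover have "(norm ?f)\<^sup>2 \<le> (a / 2)\<^sup>2" "(norm (F (z k + d)))\<^sup>2 \<le> (a / 2)\<^sup>2"
    by (rule power_mono; use small in \<open>simp add: a_def\<close>)+
  moreover have "(a / 2)\<^sup>2 = a\<^sup>2 / 4" "0 \<le> a\<^sup>2" by (simp_all add: power_divide)
  ultimately have "(norm (F (z k + d)))\<^sup>2 / 2 \<le> a\<^sup>2 / 2 + c1 * (?f \<bullet> ?g)"
    by linarith
  then have "h\<^sup>2 * ((norm (F (z k + d)))\<^sup>2 / 2) \<le> h\<^sup>2 * (a\<^sup>2 / 2 + c1 * (?f \<bullet> ?g))"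
    by (rule mult_left_mono) simp
  moreover have "merit h F (z 0) \<le> (MAX j\<in>{..k}. merit h F (z j))"
    by (rule Max_ge) auto
  ultimately show ?thesis
    by (simp add: step_accepted_def dinner_eq_inner grad merit a_def algebra_simps)
qed

theorem theorem4p4:
  fixes n :: nat
    and h \<alpha> c1 \<delta>init \<eta>max \<theta>min \<theta>max M :: real
    and ua ub f yd :: "real \<times> real \<Rightarrow> real"
    and S :: "real \<Rightarrow> real"
    and F :: "'m::{finite,linorder} pairfun \<Rightarrow> 'm pairfun"
    and G :: "'m pairfun \<Rightarrow> 'm pairmat"
    and z d :: "nat \<Rightarrow> 'm pairfun"
    and \<eta> \<delta> :: "nat \<Rightarrow> real"
    and zs :: "'m pairfun"
  assumes "n \<ge> 2" and "CARD('m) = n - 1" and "h = 1 / real n"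
    and "\<alpha> > 0"
    and "\<And>x. x \<in> Omega \<Longrightarrow> ua x \<le> ub x"
    and "\<And>y. y \<in> H1_Omega \<Longrightarrow> (\<lambda>x. deriv S (y x)) \<in> L2_Omega"
    and "F = residual_F h \<alpha> ua ub f yd S"
    and "G = slanting_G h \<alpha> ua ub S"
    and "0 < c1" and "c1 < 1" and "0 < \<delta>init" and "\<delta>init \<le> 1"
    and "0 \<le> \<eta>max" and "\<eta>max < 1"
    and "0 < \<theta>min" and "\<theta>min < \<theta>max" and "\<theta>max < 1"
    and "ISSNG_L h F G c1 \<delta>init \<eta>max \<theta>min \<theta>max \<eta> d \<delta> z"
    and "optimal_solution h F zs"
    and "assumption_A h S zs"
    and "G_bounds h G M (level_set h F (z 0))"
    and "assumption_B h G M z zs"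
    and "assumption_C h F z"
    and "\<And>k. grad_merit F G (z k) \<noteq> 0"
    and "c1 \<le> 1 / 2"
    and "\<eta> \<longlonglongrightarrow> 0"
    and "\<exists>r. strict_mono r \<and> (z \<circ> r) \<longlonglongrightarrow> zs"
  shows "z \<longlonglongrightarrow> zs \<and> dnorm h (F zs) = 0"

proof -
  have h: "0 < h" using assms(1,3) by simp
  have bounds: "ua (grid_point h i) \<le> ub (grid_point h i)" for i :: "'m node"
    using assms(5) grid_point_in_Omega[OF assms(1,2)] assms(3) by blast
  have S: "C_k 3 S" and mono: "\<And>y. 0 \<le> deriv S y"
    using assms(20) by (auto simp: assumption_A_def)
  obtain \<kappa> \<epsilon> where "0 < \<kappa>" "0 < \<epsilon>" "\<forall>w. dnorm h (w - zs) < \<epsilon> \<longrightarrow>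
      (\<forall>i. deriv (deriv S) (upper w $ i) * lower w $ i + 1 \<ge> \<kappa>)"
    using assms(20) unfolding assumption_A_def by blast
  \<comment> \<open>Only the centre of the neighbourhood is evaluated.\<close>
  from this(1,2) this(3)[rule_format, of zs]
  have coercive: "0 < deriv (deriv S) (upper zs $ i) * lower zs $ i + 1" for i
    by (simp add: dnorm_def order_less_le_trans)
  have min: "norm (F zs) \<le> norm (F w)" for w
  proof -
    have "(h * norm (F zs))\<^sup>2 \<le> (h * norm (F w))\<^sup>2"
      using assms(19) h by (simp add: optimal_solution_def merit_def dnorm_eq_norm)
    then show ?thesis using h by (simp add: power2_le_iff_abs_le)
  qed
  have zero: "F zs = 0"
    using residual_F_zero_at_minimizer[where S = S and ua = ua and ub = ub and h = h and x = zs, OF S mono assms(4) h bounds coercive] min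
    unfolding assms(7) by blast
  have slant: "(\<lambda>w. norm (F w - F zs - G w *v (w - zs))) \<in> o[nhds zs](\<lambda>w. norm (w - zs))"
    unfolding assms(7,8) by (rule semismooth_residual_F[where ua = ua and ub = ub and h = h, OF S assms(4) bounds])
  have M: "0 < M" using assms(21) by (simp add: G_bounds_def)
  \<comment> \<open>Every iterate lies in the level set on which the bounds hold.\<close>
  have inv: "invertible (G (z k))"
    and le_M: "dmatnorm h (matrix_inv (G (z k))) \<le> M" "dmatnorm h (G (z k)) \<le> M" for k
    using assms(21,23) by (auto simp: G_bounds_def assumption_C_def)
  have G_le: "norm (G (z k) *v v) \<le> M * norm v" for k v
    using norm_matrix_vector_le_dmatnorm[OF h, of "G (z k)" v] mult_right_mono[OF le_M(2)[of k], of "norm v"]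
    by simp
  have G_inv_le: "norm v \<le> M * norm (G (z k) *v v)" for k v
  proof -
    have "v = matrix_inv (G (z k)) *v (G (z k) *v v)"
      using matrix_inv_mult_self[OF inv[of k]] by (simp add: matrix_vector_mul_assoc)
    then have "norm v \<le> dmatnorm h (matrix_inv (G (z k))) * norm (G (z k) *v v)"
      using norm_matrix_vector_le_dmatnorm[OF h] by metis
    also have "\<dots> \<le> M * norm (G (z k) *v v)" by (rule mult_right_mono[OF le_M(1)]) simp
    finally show ?thesis .
  qed
  obtain \<rho> e where \<rho>: "0 < \<rho>" and e: "0 < e" and newton:
    "\<And>w v. norm (w - zs) < \<rho> \<Longrightarrow> linear ((*v) (G w)) \<Longrightarrow> (\<And>v. norm (G w *v v) \<le> M * norm v) \<Longrightarrow>
      (\<And>v. norm v \<le> M * norm (G w *v v)) \<Longrightarrow> norm (F w + G w *v v) \<le> e * norm (F w) \<Longrightarrow>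
      norm (w + v - zs) \<le> norm (w - zs) / 2"
    using inexact_newton_step_contraction[of F zs "\<lambda>w. (*v) (G w)", OF zero slant M] by blast
  \<comment> \<open>A zero initial residual would make the gradient at \<open>z 0\<close>
    vanish.\<close>
  have F0: "0 < norm (F (z 0)) / 2"
    using assms(24)[of 0] by (auto simp: grad_merit_def)
  have "isCont F zs" unfolding assms(7) by (rule isCont_residual_F[OF S assms(4)])
  then obtain \<tau> where \<tau>: "0 < \<tau>" "\<And>w. norm (w - zs) < \<tau> \<Longrightarrow> norm (F w) < norm (F (z 0)) / 2"
    using F0 unfolding continuous_at_eps_delta dist_norm zero diff_zero by blast
  obtain K where K: "\<And>k. K \<le> k \<Longrightarrow> \<eta> k < e"
    using order_tendstoD(2)[OF assms(26) e] by (auto simp: eventually_sequentially)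
  have alg: "\<eta> k \<in> {0..\<eta>max}"
    "dnorm h (F (z k) + G (z k) *v d k) \<le> \<eta> k * dnorm h (F (z k))"
    "z (Suc k) = z k + \<delta> k *\<^sub>R d k" for k
    using assms(18) unfolding ISSNG_L_def by blast+
  have res: "norm (F (z k) + G (z k) *v d k) \<le> \<eta> k * norm (F (z k))" for k
    using alg(2)[of k] h by (simp add: dnorm_eq_norm)
  obtain r where r: "strict_mono r" "(z \<circ> r) \<longlonglongrightarrow> zs" using assms(27) by blast
  have "z \<longlonglongrightarrow> zs"
  proof (rule converges_to_attracting_limit_point)
    show "0 < min \<rho> \<tau>" using \<rho> \<tau> by simp
    \<comment> \<open>The bound \<open>1 \<le> k\<close> ensures that the trial step is 1; at
      \<open>k = 0\<close> it is \<open>\<delta>init\<close>.\<close>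
    fix k assume k: "max K 1 \<le> k" and near: "dist (z k) zs < min \<rho> \<tau>"
    have "norm (F (z k) + G (z k) *v d k) \<le> e * norm (F (z k))"
      using res[of k] K[of k] k mult_right_mono[of "\<eta> k" e "norm (F (z k))"] by simp
    then have contraction: "norm (z k + d k - zs) \<le> norm (z k - zs) / 2"
      using near by (intro newton matrix_vector_mul_linear G_le G_inv_le) (simp_all add: dist_norm)
    have "norm (F (z k) + G (z k) *v d k) \<le> norm (F (z k))"
      using res[of k] alg(1)[of k] assms(14) mult_right_mono[of "\<eta> k" 1 "norm (F (z k))"] by simp
    \<comment> \<open>By contraction the full-step point is as close to \<open>zs\<close> as the
      iterate, so both residuals are below half the initial one.\<close>
    moreover have "norm (z k - zs) < \<tau>" "norm (z k + d k - zs) < \<tau>"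
      using near contraction norm_ge_zero[of "z k - zs"] by (simp_all add: dist_norm del: norm_ge_zero)
    ultimately have "step_accepted h F G c1 z (d k) k 1"
      using \<tau>(2) by (intro full_step_accepted_near_zero h assms(9) assms(25)) (simp_all add: less_imp_le)
    moreover obtain \<theta> m where "\<delta> k = \<theta> ^ m" "\<forall>j<m. \<not> step_accepted h F G c1 z (d k) k (\<theta> ^ j)"
    proof -
      have "\<exists>\<theta>\<in>{\<theta>min..\<theta>max}. \<exists>m. \<delta> k = \<theta> ^ m * (if k = 0 then \<delta>init else 1) \<and>
          (\<forall>j<m. \<not> step_accepted h F G c1 z (d k) k (\<theta> ^ j * (if k = 0 then \<delta>init else 1)))"
        using assms(18) unfolding ISSNG_L_def Let_def by blast
      then show thesis using k by (auto intro: that)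
    qed
    \<comment> \<open>A positive \<open>m\<close> would mean that the first trial,
      \<open>\<theta> ^ 0 = 1\<close>, was rejected.\<close>
    ultimately have "\<delta> k = 1" by (cases m) auto
    then show "dist (z (Suc k)) zs \<le> dist (z k) zs / 2"
      using contraction alg(3)[of k] by (simp add: dist_norm)
  qed (fact r)+
  then show ?thesis using zero by (simp add: dnorm_def)
qed

end
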